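(* Let $I,J\subset\mathbb{R}$ be nonempty open intervals, let $f:I\to\mathbb{R}$ and $g:J\to\mathbb{R}$ be smooth, and let $M$ be the Type I translation surface in $\mathbb{R}^3$ parametrized by $\mathcal{F}(u,v)=(u,v,f(u)+g(v))$, $(u,v)\in I\times J$. Then $M$ is minimal with respect to the semi-symmetric metric connection $\nabla$ if and only if $\mathcal{F}$ is of one of the following two forms on $I\times J$: (i) $\mathcal{F}(u,v)=\Big(u,\,v,\,-\frac{c^2+1}{2}\ln\Big|\cos\Big(\frac{2}{\sqrt{c^2+1}}u-a\Big)\Big|+cv+b\Big)$ for some real constants $a,b,c$ (with the cosine nonvanishing on $I$); (ii) $\mathcal{F}(u,v)=\Big(u,\,v,\,-\frac{c^2+1}{2}\ln\Big|\cos\Big(\frac{2}{\sqrt{c^2+1}}v-a\Big)\Big|+cu+b\Big)$ for some real constants $a,b,c$ (with the cosine nonvanishing on $J$).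
   Context: $\mathbb{R}^3$ carries the Euclidean metric $\widetilde g$, with coordinate fields $X_1=\partial_x$, $X_2=\partial_y$, $X_3=\partial_z$ and Levi-Civita connection $\nabla^L$ (so $\nabla^L_{X_i}X_j=0$). The semi-symmetric metric connection $\nabla$ is $$\nabla_XY=\nabla^L_XY+\widetilde g(Y,X_3)X-\widetilde g(X,Y)X_3 .$$ For an immersed surface $M$ parametrized by $\mathcal{F}(u,v)$, put $E_1=\mathcal{F}_u$, $E_2=\mathcal{F}_v$, let $N$ be a unit normal field, and let $E=\widetilde g(\mathcal{F}_u,\mathcal{F}_u)$, $F=\widetilde g(\mathcal{F}_u,\mathcal{F}_v)$, $G=\widetilde g(\mathcal{F}_v,\mathcal{F}_v)$. With $\sigma(X,Y)=\widetilde g(\nabla_XY,N)$ for $X,Y$ tangent to $M$ (not symmetric in general), the mean curvature with respect to $\nabla$ is $H=\frac12[\sigma(e_1,e_1)+\sigma(e_2,e_2)]$ for an orthonormal basis $e_1,e_2$ of $TM$, i.e. $$H=\frac{G\,\widetilde g(\nabla_{E_1}E_1,N)-F\,\widetilde g(\nabla_{E_1}E_2,N)-F\,\widetilde g(\nabla_{E_2}E_1,N)+E\,\widetilde g(\nabla_{E_2}E_2,N)}{2(EG-F^2)} .$$ $M$ is minimal with respect to $\nabla$ if $H=0$ everywhere. *)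

theory Defs
  imports "HOL-Analysis.Analysis"
begin

text \<open>Meaningful for open \<open>S\<close>, where no iterated derivative at a point of \<open>S\<close> depends on the
  values of \<open>f\<close> outside \<open>S\<close>.\<close>

definition smooth_on :: "real set \<Rightarrow> (real \<Rightarrow> real) \<Rightarrow> bool" where
  "smooth_on S f \<longleftrightarrow> (\<forall>k. \<forall>x\<in>S. (deriv ^^ k) f differentiable (at x))"

definition X3 :: "real ^ 3" where
  "X3 = axis 3 1"

definition levi_civita ::
    "(real ^ 3 \<Rightarrow> real ^ 3) \<Rightarrow> (real ^ 3 \<Rightarrow> real ^ 3) \<Rightarrow> real ^ 3 \<Rightarrow> real ^ 3" where
  "levi_civita X Y p = frechet_derivative Y (at p) (X p)"

definition semi_symmetric_conn ::
    "(real ^ 3 \<Rightarrow> real ^ 3) \<Rightarrow> (real ^ 3 \<Rightarrow> real ^ 3) \<Rightarrow> real ^ 3 \<Rightarrow> real ^ 3" where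
  "semi_symmetric_conn X Y p =
     levi_civita X Y p + (Y p \<bullet> X3) *\<^sub>R X p - (X p \<bullet> Y p) *\<^sub>R X3"

text \<open>For a parametrized surface \<open>F\<close>, the field \<open>dF(w)\<close> along \<open>F\<close>; \<open>F\<^sub>u\<close> and \<open>F\<^sub>v\<close> are the
  cases \<open>w = (1,0)\<close> and \<open>w = (0,1)\<close>.\<close>

definition tangent_field ::
    "(real \<times> real \<Rightarrow> real ^ 3) \<Rightarrow> real \<times> real \<Rightarrow> real \<times> real \<Rightarrow> real ^ 3" where
  "tangent_field F w q = frechet_derivative F (at q) w"

abbreviation E1 :: "(real \<times> real \<Rightarrow> real ^ 3) \<Rightarrow> real \<times> real \<Rightarrow> real ^ 3" where
  "E1 F \<equiv> tangent_field F (1, 0)"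

abbreviation E2 :: "(real \<times> real \<Rightarrow> real ^ 3) \<Rightarrow> real \<times> real \<Rightarrow> real ^ 3" where
  "E2 F \<equiv> tangent_field F (0, 1)"

text \<open>The fields \<open>E1 F\<close> and \<open>E2 F\<close> live on the parameter domain, so the semi-symmetric metric
  connection is applied to them through its pullback along \<open>F\<close>: \<open>conn_along F w Y\<close> is the
  derivative of the field \<open>Y\<close> along \<open>F\<close> in the direction \<open>dF(w)\<close>. The lemma below shows that it
  agrees with the ambient connection on restrictions of ambient fields.\<close>

definition conn_along ::
    "(real \<times> real \<Rightarrow> real ^ 3) \<Rightarrow> real \<times> real \<Rightarrow> (real \<times> real \<Rightarrow> real ^ 3)
      \<Rightarrow> real \<times> real \<Rightarrow> real ^ 3" where
  "conn_along F w Y q =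
     frechet_derivative Y (at q) w + (Y q \<bullet> X3) *\<^sub>R tangent_field F w q
       - (tangent_field F w q \<bullet> Y q) *\<^sub>R X3"

lemma conn_along_comp:
  assumes "F differentiable (at q)" and "Y differentiable (at (F q))"
    and "X (F q) = tangent_field F w q"
  shows "conn_along F w (Y \<circ> F) q = semi_symmetric_conn X Y (F q)"
  using assms
  by (simp add: conn_along_def semi_symmetric_conn_def levi_civita_def tangent_field_def
      frechet_derivative_compose)

text \<open>For an immersion, a continuous unit normal is automatically as smooth as \<open>dF\<close>.\<close>

definition unit_normal_field ::
    "(real \<times> real \<Rightarrow> real ^ 3) \<Rightarrow> (real \<times> real) set \<Rightarrow> (real \<times> real \<Rightarrow> real ^ 3) \<Rightarrow> bool" where
  "unit_normal_field F D N \<longleftrightarrow> continuous_on D N \<and>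
     (\<forall>q\<in>D. norm (N q) = 1 \<and> N q \<bullet> E1 F q = 0 \<and> N q \<bullet> E2 F q = 0)"

text \<open>\<open>sigma F N w w' q\<close> is \<open>\<sigma>(dF(w), dF(w'))\<close> at \<open>q\<close>.\<close>

definition sigma ::
    "(real \<times> real \<Rightarrow> real ^ 3) \<Rightarrow> (real \<times> real \<Rightarrow> real ^ 3)
      \<Rightarrow> real \<times> real \<Rightarrow> real \<times> real \<Rightarrow> real \<times> real \<Rightarrow> real" where
  "sigma F N w w' q = conn_along F w (tangent_field F w') q \<bullet> N q"

definition mean_curvature ::
    "(real \<times> real \<Rightarrow> real ^ 3) \<Rightarrow> (real \<times> real \<Rightarrow> real ^ 3) \<Rightarrow> real \<times> real \<Rightarrow> real" where
  "mean_curvature F N q =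
     (let EE = E1 F q \<bullet> E1 F q; FF = E1 F q \<bullet> E2 F q; GG = E2 F q \<bullet> E2 F q
      in (GG * sigma F N (1, 0) (1, 0) q - FF * sigma F N (1, 0) (0, 1) q
            - FF * sigma F N (0, 1) (1, 0) q + EE * sigma F N (0, 1) (0, 1) q)
         / (2 * (EE * GG - FF\<^sup>2)))"

definition minimal_surface ::
    "(real \<times> real \<Rightarrow> real ^ 3) \<Rightarrow> (real \<times> real) set \<Rightarrow> (real \<times> real \<Rightarrow> real ^ 3) \<Rightarrow> bool" where
  "minimal_surface F D N \<longleftrightarrow> (\<forall>q\<in>D. mean_curvature F N q = 0)"

definition translation_surface ::
    "(real \<Rightarrow> real) \<Rightarrow> (real \<Rightarrow> real) \<Rightarrow> real \<times> real \<Rightarrow> real ^ 3" where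
  "translation_surface f g = (\<lambda>(u, v). vector [u, v, f u + g v])"

end

theory Submission
  imports Defs
begin

text \<open>
  The proof has a geometric half and an analytic half.

  Geometry. Write \<open>p = f'\<close> and \<open>q = g'\<close>. Since \<open>N\<close> is orthogonal to the tangent plane, the term
  \<open>(Y \<bullet> X3) X\<close> of the connection contributes nothing to \<open>\<sigma>\<close>, and every remaining term is
  a multiple of \<open>X3\<close>. Hence \<open>\<sigma>\<close> is the Hessian of \<open>f(u) + g(v)\<close> minus the first fundamental form,
  times the third component of \<open>N\<close> (\<open>sigma_translation_surface\<close>). That component never vanishes,
  because a graph has no vertical tangent plane, so minimality is the equation
  \<open>(1 + q^2) p' + (1 + p^2) q' = 2 (1 + p^2 + q^2)\<close>
  on \<open>I \<times> J\<close> (\<open>mean_curvature_translation_surface_eq_0_iff\<close>).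

  Analysis. Division by \<open>(1 + p^2)(1 + q^2)\<close> gives
  \<open>p'/(1 + p^2) + q'/(1 + q^2) = 2 - 2 (p^2/(1 + p^2)) (q^2/(1 + q^2))\<close>.
  The left-hand side is a function of \<open>u\<close> plus a function of \<open>v\<close>, so its mixed second
  difference vanishes, and one of the two factors on the right must be constant
  (\<open>separated_sum_eq_product\<close>). A constant \<open>q^2/(1 + q^2)\<close> forces \<open>q\<close> to be a constant \<open>c\<close>
  (\<open>deriv_zero_if_square_ratio_constant\<close>). The equation is then the Riccati equation
  \<open>(1 + c^2) p' = 2 (1 + c^2 + p^2)\<close>. In terms of the angle \<open>\<theta> = arctan (p / sqrt (1 + c^2))\<close>
  it says \<open>\<theta>' = 2 / sqrt (1 + c^2)\<close>, and two integrations give the logarithm of a cosine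
  (\<open>riccati_iff_ln_cos\<close>). The two forms of the theorem correspond to which of \<open>q\<close> and \<open>p\<close> is
  constant, and are interchanged by swapping the two profile functions.
\<close>

section \<open>The minimal surface equation of a translation surface\<close>

lemma vector_3_eq_axis_sum:
  "(vector [a, b, c] :: real ^ 3) = a *\<^sub>R axis 1 1 + b *\<^sub>R axis 2 1 + c *\<^sub>R axis 3 1"
  by (simp add: vec_eq_iff forall_3 axis_def)

lemma inner_vector_3:
  "(vector [a, b, c] :: real ^ 3) \<bullet> w = a * w $ 1 + b * w $ 2 + c * w $ 3"
  by (simp add: inner_vec_def sum_3)

lemma has_derivative_vector_3:
  assumes "(A has_derivative A') F" "(B has_derivative B') F" "(C has_derivative C') F"
  shows "((\<lambda>q. vector [A q, B q, C q] :: real ^ 3) has_derivative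
           (\<lambda>h. vector [A' h, B' h, C' h])) F"
  unfolding vector_3_eq_axis_sum
  by (intro derivative_intros assms)

lemma has_derivative_separated_sum:
  fixes f g :: "real \<Rightarrow> real"
  assumes "f differentiable (at u)" "g differentiable (at v)"
  shows "((\<lambda>q. f (fst q) + g (snd q)) has_derivative
           (\<lambda>h. deriv f u * fst h + deriv g v * snd h)) (at (u, v))"
proof -
  have f: "(f has_derivative (*) (deriv f u)) (at (fst (u, v)))"
    using assms(1) DERIV_deriv_iff_real_differentiable has_field_derivative_def by fastforce
  have g: "(g has_derivative (*) (deriv g v)) (at (snd (u, v)))"
    using assms(2) DERIV_deriv_iff_real_differentiable has_field_derivative_def by fastforce
  have "((\<lambda>q. f (fst q)) has_derivative (\<lambda>h. deriv f u * fst h)) (at (u, v))"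
    by (rule has_derivative_compose[OF has_derivative_fst[OF has_derivative_ident] f])
  moreover have "((\<lambda>q. g (snd q)) has_derivative (\<lambda>h. deriv g v * snd h)) (at (u, v))"
    by (rule has_derivative_compose[OF has_derivative_snd[OF has_derivative_ident] g])
  ultimately show ?thesis
    by (rule has_derivative_add)
qed

lemma tangent_field_translation_surface:
  assumes "f differentiable (at u)" "g differentiable (at v)"
  shows "tangent_field (translation_surface f g) (x, y) (u, v) =
           vector [x, y, deriv f u * x + deriv g v * y]"
proof -
  have "(translation_surface f g has_derivative
          (\<lambda>h. vector [fst h, snd h, deriv f u * fst h + deriv g v * snd h])) (at (u, v))"
    unfolding translation_surface_def case_prod_beta
    by (intro has_derivative_vector_3 has_derivative_separated_sum derivative_intros assms)
  then show ?thesis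
    by (simp add: tangent_field_def frechet_derivative_at[symmetric])
qed

text \<open>The formula for a tangent field can be differentiated only because it holds on a whole
  neighbourhood of the point; this is where the openness of \<open>I\<close> and \<open>J\<close> enters.\<close>

lemma frechet_derivative_tangent_field_translation_surface:
  assumes "open I" "open J" "u \<in> I" "v \<in> J"
    and f: "\<And>s. s \<in> I \<Longrightarrow> f differentiable (at s)" "deriv f differentiable (at u)"
    and g: "\<And>t. t \<in> J \<Longrightarrow> g differentiable (at t)" "deriv g differentiable (at v)"
  shows "frechet_derivative (tangent_field (translation_surface f g) (x', y')) (at (u, v)) (x, y) =
           vector [0, 0, deriv (deriv f) u * x * x' + deriv (deriv g) v * y * y']"
proof -
  have third: "((\<lambda>q. deriv f (fst q) * x' + deriv g (snd q) * y') has_derivative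
          (\<lambda>h. deriv (deriv f) u * fst h * x' + deriv (deriv g) v * snd h * y')) (at (u, v))"
  proof -
    have *: "(\<lambda>t. deriv f t * x') differentiable (at u)" "(\<lambda>t. deriv g t * y') differentiable (at v)"
      using f(2) g(2) by (auto intro: differentiable_mult)
    have "deriv (\<lambda>t. deriv f t * x') u = deriv (deriv f) u * x'"
      "deriv (\<lambda>t. deriv g t * y') v = deriv (deriv g) v * y'"
      using f(2) g(2) DERIV_deriv_iff_real_differentiable
      by (auto intro!: DERIV_imp_deriv DERIV_cmult_right)
    then show ?thesis
      using has_derivative_separated_sum[OF *] by (simp add: mult_ac)
  qed
  have "((\<lambda>q. vector [x', y', deriv f (fst q) * x' + deriv g (snd q) * y'] :: real ^ 3)
          has_derivative (\<lambda>h. vector [0, 0, deriv (deriv f) u * fst h * x'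
                                              + deriv (deriv g) v * snd h * y'])) (at (u, v))"
    by (intro has_derivative_vector_3 third has_derivative_const)
  then have "(tangent_field (translation_surface f g) (x', y') has_derivative
          (\<lambda>h. vector [0, 0, deriv (deriv f) u * fst h * x' + deriv (deriv g) v * snd h * y']))
          (at (u, v))"
    by (rule has_derivative_transform_within_open[where s = "I \<times> J"])
      (use assms in \<open>auto simp: open_Times tangent_field_translation_surface\<close>)
  then show ?thesis
    by (simp add: frechet_derivative_at[symmetric])
qed

text \<open>The second fundamental form of \<open>\<nabla>\<close> on the graph of a separated sum: the Euclidean part
  is the diagonal Hessian, and the term \<open>- (X \<bullet> Y) X3\<close> of \<open>\<nabla>\<close> subtracts the first
  fundamental form. The tangential term of \<open>\<nabla>\<close> is annihilated by \<open>N\<close>.\<close>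

lemma sigma_translation_surface:
  fixes N :: "real \<times> real \<Rightarrow> real ^ 3"
  assumes "open I" "open J" "u \<in> I" "v \<in> J"
    and f: "\<And>s. s \<in> I \<Longrightarrow> f differentiable (at s)" "deriv f differentiable (at u)"
    and g: "\<And>t. t \<in> J \<Longrightarrow> g differentiable (at t)" "deriv g differentiable (at v)"
    and N: "N (u, v) $ 1 = - deriv f u * N (u, v) $ 3" "N (u, v) $ 2 = - deriv g v * N (u, v) $ 3"
  shows "sigma (translation_surface f g) N (x, y) (x', y') (u, v) =
    (deriv (deriv f) u * x * x' + deriv (deriv g) v * y * y'
       - (x * x' + y * y' + (deriv f u * x + deriv g v * y) * (deriv f u * x' + deriv g v * y')))
    * N (u, v) $ 3"
proof -
  have X3: "X3 \<bullet> w = w $ 3" for w :: "real ^ 3"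
    by (simp add: X3_def inner_axis')
  show ?thesis
    using assms
    by (simp add: sigma_def conn_along_def frechet_derivative_tangent_field_translation_surface
          tangent_field_translation_surface inner_add_left inner_diff_left X3 inner_vector_3
          algebra_simps)
qed

lemma mean_curvature_translation_surface_eq_0_iff:
  assumes "open I" "open J" "u \<in> I" "v \<in> J"
    and f: "\<And>s. s \<in> I \<Longrightarrow> f differentiable (at s)" "deriv f differentiable (at u)"
    and g: "\<And>t. t \<in> J \<Longrightarrow> g differentiable (at t)" "deriv g differentiable (at v)"
    and N: "unit_normal_field (translation_surface f g) (I \<times> J) N"
  shows "mean_curvature (translation_surface f g) N (u, v) = 0 \<longleftrightarrow>
    (1 + (deriv g v)\<^sup>2) * deriv (deriv f) u + (1 + (deriv f u)\<^sup>2) * deriv (deriv g) v =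
      2 * (1 + (deriv f u)\<^sup>2 + (deriv g v)\<^sup>2)"
proof -
  let ?n = "N (u, v)" and ?p = "deriv f u" and ?q = "deriv g v"
  let ?p' = "deriv (deriv f) u" and ?q' = "deriv (deriv g) v"
  note tangent = tangent_field_translation_surface[OF f(1)[OF \<open>u \<in> I\<close>] g(1)[OF \<open>v \<in> J\<close>]]
  have "?n \<bullet> E1 (translation_surface f g) (u, v) = 0" "?n \<bullet> E2 (translation_surface f g) (u, v) = 0"
    and unit: "norm ?n = 1"
    using N \<open>u \<in> I\<close> \<open>v \<in> J\<close> by (auto simp: unit_normal_field_def)
  then have n: "?n $ 1 = - ?p * ?n $ 3" "?n $ 2 = - ?q * ?n $ 3"
    unfolding tangent by (simp_all add: inner_commute[of ?n] inner_vector_3)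
  have "?n $ 3 \<noteq> 0"
  proof
    assume "?n $ 3 = 0"
    with n have "?n = 0" by (simp add: vec_eq_iff forall_3)
    with unit show False by simp
  qed
  have sigma: "sigma (translation_surface f g) N (x, y) (x', y') (u, v) =
      (?p' * x * x' + ?q' * y * y' - (x * x' + y * y' + (?p * x + ?q * y) * (?p * x' + ?q * y')))
      * ?n $ 3" for x y x' y'
    by (rule sigma_translation_surface[OF assms(1-4)]) (use f g n in auto)
  have det: "(1 + ?p\<^sup>2) * (1 + ?q\<^sup>2) - (?p * ?q)\<^sup>2 = 1 + ?p\<^sup>2 + ?q\<^sup>2"
    by (simp add: algebra_simps power2_eq_square)
  have pos: "1 + ?p\<^sup>2 + ?q\<^sup>2 > 0"
    by (simp add: add_pos_nonneg)
  have "mean_curvature (translation_surface f g) N (u, v) =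
      ((1 + ?q\<^sup>2) * ?p' + (1 + ?p\<^sup>2) * ?q' - 2 * (1 + ?p\<^sup>2 + ?q\<^sup>2)) * ?n $ 3
        / (2 * ((1 + ?p\<^sup>2) * (1 + ?q\<^sup>2) - (?p * ?q)\<^sup>2))"
    unfolding mean_curvature_def Let_def sigma tangent
    by (simp add: inner_vector_3 algebra_simps power2_eq_square)
  then show ?thesis
    using \<open>?n $ 3 \<noteq> 0\<close> pos unfolding det by simp
qed

section \<open>Separation of variables\<close>

lemma separated_sum_eq_product:
  fixes A P :: "'a \<Rightarrow> real" and B Q :: "'b \<Rightarrow> real"
  assumes eq: "\<And>u v. u \<in> I \<Longrightarrow> v \<in> J \<Longrightarrow> A u + B v = 2 - 2 * P u * Q v"
  shows "(\<forall>u\<in>I. \<forall>u'\<in>I. P u = P u') \<or> (\<forall>v\<in>J. \<forall>v'\<in>J. Q v = Q v')"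
proof -
  (* The mixed second difference of the left-hand side vanishes. *)
  have "(P u - P u') * (Q v - Q v') = 0"
    if "u \<in> I" "u' \<in> I" "v \<in> J" "v' \<in> J" for u u' v v'
    using eq[OF that(1,3)] eq[OF that(1,4)] eq[OF that(2,3)] eq[OF that(2,4)]
    by (simp add: algebra_simps)
  then show ?thesis
    by (metis mult_eq_0_iff right_minus_eq)
qed

lemma deriv_zero_if_constant_on_open:
  assumes "open J" "v \<in> J" "\<forall>t\<in>J. q t = (c :: real)"
  shows "deriv q v = 0"
  by (rule DERIV_imp_deriv, rule has_field_derivative_transform_within_open[OF DERIV_const[of c]
        assms(1,2)]) (use assms(3) in simp)

text \<open>The square of \<open>q\<close> is a strictly increasing function of \<open>q^2/(1 + q^2)\<close>, hence constant, so
  \<open>q q' = 0\<close>; where \<open>q\<close> vanishes at one point it vanishes everywhere.\<close>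

lemma deriv_zero_if_square_ratio_constant:
  fixes q :: "real \<Rightarrow> real"
  assumes "open J" "v \<in> J" "q differentiable (at v)"
    and const: "\<And>t. t \<in> J \<Longrightarrow> (q t)\<^sup>2 / (1 + (q t)\<^sup>2) = (q v)\<^sup>2 / (1 + (q v)\<^sup>2)"
  shows "deriv q v = 0"
proof -
  have square: "(q t)\<^sup>2 = (q v)\<^sup>2" if "t \<in> J" for t
  proof -
    have "1 + (q t)\<^sup>2 > 0" "1 + (q v)\<^sup>2 > 0" by (simp_all add: add_pos_nonneg)
    with const[OF that] show ?thesis by (simp add: field_simps)
  qed
  show ?thesis
  proof (cases "q v = 0")
    case True
    then have "\<forall>t\<in>J. q t = 0"
      using square by simp
    then show ?thesis
      by (rule deriv_zero_if_constant_on_open[OF \<open>open J\<close> \<open>v \<in> J\<close>])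
  next
    case False
    have "((\<lambda>t. (q t)\<^sup>2) has_field_derivative 2 * q v * deriv q v) (at v)"
      using assms(3) unfolding DERIV_deriv_iff_real_differentiable[symmetric]
      by (auto intro!: derivative_eq_intros)
    moreover have "((\<lambda>t. (q t)\<^sup>2) has_field_derivative 0) (at v)"
      by (rule has_field_derivative_transform_within_open[OF DERIV_const[of "(q v)\<^sup>2"]
            \<open>open J\<close> \<open>v \<in> J\<close>]) (simp add: square)
    ultimately have "2 * q v * deriv q v = 0"
      by (rule DERIV_unique)
    with False show ?thesis by simp
  qed
qed

lemma constant_if_deriv_zero_on_interval:
  fixes q :: "real \<Rightarrow> real"
  assumes "is_interval J" "J \<noteq> {}"
    and "\<And>v. v \<in> J \<Longrightarrow> (q has_field_derivative 0) (at v)"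
  shows "\<exists>c. \<forall>v\<in>J. q v = c"
  using has_field_derivative_zero_constant[of J q] assms
  by (metis has_field_derivative_at_within is_interval_convex_1)

lemma minimal_equation_imp_constant_slope:
  fixes f g :: "real \<Rightarrow> real"
  assumes "open I" "is_interval I" "I \<noteq> {}" "open J" "is_interval J" "J \<noteq> {}"
    and f: "\<And>u. u \<in> I \<Longrightarrow> deriv f differentiable (at u)"
    and g: "\<And>v. v \<in> J \<Longrightarrow> deriv g differentiable (at v)"
    and eq: "\<And>u v. u \<in> I \<Longrightarrow> v \<in> J \<Longrightarrow>
      (1 + (deriv g v)\<^sup>2) * deriv (deriv f) u + (1 + (deriv f u)\<^sup>2) * deriv (deriv g) v =
        2 * (1 + (deriv f u)\<^sup>2 + (deriv g v)\<^sup>2)"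
  shows "(\<exists>c. \<forall>u\<in>I. deriv f u = c) \<or> (\<exists>c. \<forall>v\<in>J. deriv g v = c)"
proof -
  let ?R = "\<lambda>x :: real. x\<^sup>2 / (1 + x\<^sup>2)"
  have slope: "\<exists>c. \<forall>t\<in>K. deriv h t = c"
    if K: "open K" "is_interval K" "K \<noteq> {}" "\<And>t. t \<in> K \<Longrightarrow> deriv h differentiable (at t)"
      and R: "\<forall>t\<in>K. \<forall>t'\<in>K. ?R (deriv h t) = ?R (deriv h t')" for K and h :: "real \<Rightarrow> real"
  proof -
    have "(deriv h has_field_derivative 0) (at t)" if "t \<in> K" for t
      using deriv_zero_if_square_ratio_constant[OF K(1) that K(4)[OF that]] R K(4)[OF that] that
      by (metis DERIV_deriv_iff_real_differentiable)
    then show ?thesis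
      by (rule constant_if_deriv_zero_on_interval[OF K(2,3)])
  qed
  have "deriv (deriv f) u / (1 + (deriv f u)\<^sup>2) + deriv (deriv g) v / (1 + (deriv g v)\<^sup>2) =
      2 - 2 * ?R (deriv f u) * ?R (deriv g v)" if "u \<in> I" "v \<in> J" for u v
  proof -
    have "1 + (deriv f u)\<^sup>2 > 0" "1 + (deriv g v)\<^sup>2 > 0" by (simp_all add: add_pos_nonneg)
    with eq[OF that] show ?thesis
      by (simp add: divide_simps) (simp add: algebra_simps)
  qed
  from separated_sum_eq_product[where P = "\<lambda>u. ?R (deriv f u)" and Q = "\<lambda>v. ?R (deriv g v)", OF this]
  show ?thesis
    using slope[OF assms(1-3) f] slope[OF assms(4-6) g] by blast
qed

section \<open>The Riccati equation\<close>

text \<open>The primitive of the explicit solution \<open>s tan (2 u / s - a)\<close> of the Riccati equation.\<close>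

lemma has_field_derivative_ln_cos:
  fixes s a u :: real
  assumes "s > 0" "cos (2 / s * u - a) \<noteq> 0"
  shows "((\<lambda>u. - (s\<^sup>2 / 2) * ln \<bar>cos (2 / s * u - a)\<bar>) has_field_derivative
           s * tan (2 / s * u - a)) (at u)"
proof -
  (* Writing ln |x| as half of ln (x^2) avoids differentiating the absolute value. *)
  have ln_abs: "ln \<bar>x\<bar> = ln (x\<^sup>2) / 2" for x :: real
    using ln_realpow[of "\<bar>x\<bar>" 2] by (cases "x = 0") simp_all
  have "(cos (2 / s * u - a))\<^sup>2 > 0" using assms(2) by simp
  then show ?thesis
    unfolding ln_abs using assms
    by (auto intro!: derivative_eq_intros simp: tan_def field_simps power2_eq_square)
qed

text \<open>The angle \<open>\<theta> = arctan (p / s)\<close> linearizes the equation: \<open>\<theta>' = 2 / s\<close>. Conversely a solution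
  of the stated form has slope \<open>s tan (2 u / s - a)\<close>, whose derivative is \<open>2 + 2 tan^2\<close>.\<close>

lemma riccati_iff_ln_cos:
  fixes f :: "real \<Rightarrow> real" and s :: real
  assumes "open I" "is_interval I" "I \<noteq> {}" "s > 0"
    and f: "\<And>u. u \<in> I \<Longrightarrow> f differentiable (at u)"
    and f': "\<And>u. u \<in> I \<Longrightarrow> deriv f differentiable (at u)"
  shows "(\<forall>u\<in>I. s\<^sup>2 * deriv (deriv f) u = 2 * (s\<^sup>2 + (deriv f u)\<^sup>2)) \<longleftrightarrow>
    (\<exists>a b. \<forall>u\<in>I. cos (2 / s * u - a) \<noteq> 0 \<and>
       f u = - (s\<^sup>2 / 2) * ln \<bar>cos (2 / s * u - a)\<bar> + b)"
proof
  assume eq: "\<forall>u\<in>I. s\<^sup>2 * deriv (deriv f) u = 2 * (s\<^sup>2 + (deriv f u)\<^sup>2)"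
  have "((\<lambda>u. 2 / s * u - arctan (deriv f u / s)) has_field_derivative 0) (at u)"
    if "u \<in> I" for u
  proof -
    have D: "(deriv f has_field_derivative deriv (deriv f) u) (at u)"
      using f'[OF that] by (simp add: DERIV_deriv_iff_real_differentiable)
    have "((\<lambda>u. 2 / s * u - arctan (deriv f u / s)) has_field_derivative
        2 / s - (deriv (deriv f) u / s) * inverse (1 + (deriv f u / s)\<^sup>2)) (at u)"
      using \<open>s > 0\<close> by (auto intro!: derivative_eq_intros D)
    moreover have "2 / s - (deriv (deriv f) u / s) * inverse (1 + (deriv f u / s)\<^sup>2) = 0"
    proof -
      have pos: "s\<^sup>2 + (deriv f u)\<^sup>2 > 0" using \<open>s > 0\<close> by (simp add: add_pos_nonneg)
      have "(deriv (deriv f) u / s) * inverse (1 + (deriv f u / s)\<^sup>2)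
          = (s\<^sup>2 * deriv (deriv f) u) / (s * (s\<^sup>2 + (deriv f u)\<^sup>2))"
        using \<open>s > 0\<close> pos by (simp add: field_simps)
      also have "\<dots> = (2 * (s\<^sup>2 + (deriv f u)\<^sup>2)) / (s * (s\<^sup>2 + (deriv f u)\<^sup>2))"
        using eq that by metis
      also have "\<dots> = 2 / s"
        using less_imp_neq[OF pos] by (intro mult_divide_mult_cancel_right) metis
      finally show ?thesis by simp
    qed
    ultimately show ?thesis by (simp only:)
  qed
  then have "\<exists>a. \<forall>u\<in>I. 2 / s * u - arctan (deriv f u / s) = a"
    by (rule constant_if_deriv_zero_on_interval[OF assms(2,3)])
  then obtain a where a: "2 / s * u - arctan (deriv f u / s) = a" if "u \<in> I" for u
    by blast
  have angle: "2 / s * u - a = arctan (deriv f u / s)" if "u \<in> I" for u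
    using a[OF that] by simp
  have cos: "cos (2 / s * u - a) \<noteq> 0" and slope: "s * tan (2 / s * u - a) = deriv f u"
    if "u \<in> I" for u
    unfolding angle[OF that] using \<open>s > 0\<close> by (simp_all add: tan_arctan)
  have "((\<lambda>u. f u - (- (s\<^sup>2 / 2) * ln \<bar>cos (2 / s * u - a)\<bar>)) has_field_derivative 0) (at u)"
    if "u \<in> I" for u
    using DERIV_diff[OF f[OF that, folded DERIV_deriv_iff_real_differentiable]
        has_field_derivative_ln_cos[OF \<open>s > 0\<close> cos[OF that]]] slope[OF that]
    by simp
  then have "\<exists>b. \<forall>u\<in>I. f u - (- (s\<^sup>2 / 2) * ln \<bar>cos (2 / s * u - a)\<bar>) = b"
    by (rule constant_if_deriv_zero_on_interval[OF assms(2,3)])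
  then obtain b where "f u - (- (s\<^sup>2 / 2) * ln \<bar>cos (2 / s * u - a)\<bar>) = b" if "u \<in> I" for u
    by blast
  then have "\<forall>u\<in>I. cos (2 / s * u - a) \<noteq> 0 \<and>
      f u = - (s\<^sup>2 / 2) * ln \<bar>cos (2 / s * u - a)\<bar> + b"
    using cos by (metis add.commute diff_add_cancel)
  then show "\<exists>a b. \<forall>u\<in>I. cos (2 / s * u - a) \<noteq> 0 \<and>
      f u = - (s\<^sup>2 / 2) * ln \<bar>cos (2 / s * u - a)\<bar> + b"
    by blast
next
  assume "\<exists>a b. \<forall>u\<in>I. cos (2 / s * u - a) \<noteq> 0 \<and>
      f u = - (s\<^sup>2 / 2) * ln \<bar>cos (2 / s * u - a)\<bar> + b"
  then obtain a b where cos: "\<And>u. u \<in> I \<Longrightarrow> cos (2 / s * u - a) \<noteq> 0"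
    and f_eq: "\<And>u. u \<in> I \<Longrightarrow> f u = - (s\<^sup>2 / 2) * ln \<bar>cos (2 / s * u - a)\<bar> + b"
    by blast
  have slope: "deriv f u = s * tan (2 / s * u - a)" if "u \<in> I" for u
  proof (rule DERIV_imp_deriv)
    have "((\<lambda>u. - (s\<^sup>2 / 2) * ln \<bar>cos (2 / s * u - a)\<bar> + b) has_field_derivative
        s * tan (2 / s * u - a)) (at u)"
      using DERIV_add[OF has_field_derivative_ln_cos[OF \<open>s > 0\<close> cos[OF that]] DERIV_const[of b]]
      by simp
    then show "(f has_field_derivative s * tan (2 / s * u - a)) (at u)"
      by (rule has_field_derivative_transform_within_open[OF _ \<open>open I\<close> that]) (simp add: f_eq)
  qed
  have "deriv (deriv f) u = 2 * (1 + (tan (2 / s * u - a))\<^sup>2)" if "u \<in> I" for u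
  proof (rule DERIV_imp_deriv)
    have "((\<lambda>u. s * tan (2 / s * u - a)) has_field_derivative
        2 * (1 + (tan (2 / s * u - a))\<^sup>2)) (at u)"
      using \<open>s > 0\<close> cos[OF that]
      by (auto intro!: derivative_eq_intros simp: tan_sec power_inverse)
    then show "(deriv f has_field_derivative 2 * (1 + (tan (2 / s * u - a))\<^sup>2)) (at u)"
      by (rule has_field_derivative_transform_within_open[OF _ \<open>open I\<close> that]) (simp add: slope)
  qed
  then show "\<forall>u\<in>I. s\<^sup>2 * deriv (deriv f) u = 2 * (s\<^sup>2 + (deriv f u)\<^sup>2)"
    by (simp add: slope algebra_simps power_mult_distrib)
qed

section \<open>Minimal translation surfaces\<close>

text \<open>Both forms in the theorem say that one profile function is affine of slope \<open>c\<close> and the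
  other solves the Riccati equation for that \<open>c\<close>. Only the sum \<open>f u + g v\<close> is prescribed, so the
  additive constants of the two profiles are recovered by fixing one of the variables.\<close>

lemma explicit_form_iff:
  fixes f g :: "real \<Rightarrow> real"
  assumes I: "open I" "is_interval I" "I \<noteq> {}" and J: "open J" "is_interval J" "J \<noteq> {}"
    and f: "\<forall>u\<in>I. f differentiable (at u)" "\<forall>u\<in>I. deriv f differentiable (at u)"
    and g: "\<forall>v\<in>J. g differentiable (at v)"
  shows "(\<exists>a b c. (\<forall>u\<in>I. cos (2 / sqrt (c\<^sup>2 + 1) * u - a) \<noteq> 0) \<and>
      (\<forall>u\<in>I. \<forall>v\<in>J. f u + g v =
         - ((c\<^sup>2 + 1) / 2) * ln \<bar>cos (2 / sqrt (c\<^sup>2 + 1) * u - a)\<bar> + c * v + b)) \<longleftrightarrow>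
    (\<exists>c. (\<forall>v\<in>J. deriv g v = c) \<and>
       (\<forall>u\<in>I. (1 + c\<^sup>2) * deriv (deriv f) u = 2 * (1 + c\<^sup>2 + (deriv f u)\<^sup>2)))"
    (is "(\<exists>a b c. ?form a b c) \<longleftrightarrow> (\<exists>c. ?affine c \<and> ?riccati c)")
proof -
  have "(\<exists>a b. ?form a b c) \<longleftrightarrow> ?affine c \<and> ?riccati c" for c
  proof -
    let ?C = "\<lambda>a u. cos (2 / sqrt (c\<^sup>2 + 1) * u - a)"
    let ?h = "\<lambda>a u. - ((c\<^sup>2 + 1) / 2) * ln \<bar>?C a u\<bar>"
    have s: "sqrt (c\<^sup>2 + 1) > 0" "(sqrt (c\<^sup>2 + 1))\<^sup>2 = c\<^sup>2 + 1"
      by (simp_all add: add_nonneg_pos)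
    have solution: "?riccati c \<longleftrightarrow> (\<exists>a b. \<forall>u\<in>I. ?C a u \<noteq> 0 \<and> f u = ?h a u + b)"
      using riccati_iff_ln_cos[OF I s(1) f[rule_format]] by (simp add: s(2) add.commute)
    obtain u0 v0 where "u0 \<in> I" "v0 \<in> J"
      using I J by blast
    show ?thesis
    proof
      assume "\<exists>a b. ?form a b c"
      then obtain a b where C: "\<forall>u\<in>I. ?C a u \<noteq> 0"
        and sum: "\<And>u v. u \<in> I \<Longrightarrow> v \<in> J \<Longrightarrow> f u + g v = ?h a u + c * v + b"
        by blast
      have "f u = ?h a u + (c * v0 + b - g v0)" if "u \<in> I" for u
        using sum[OF that \<open>v0 \<in> J\<close>] by linarith
      with C have "?riccati c"
        unfolding solution by blast
      moreover have "deriv g v = c" if "v \<in> J" for v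
      proof (rule DERIV_imp_deriv)
        have "((\<lambda>v. c * v + (?h a u0 + b - f u0)) has_field_derivative c) (at v)"
          by (auto intro!: derivative_eq_intros)
        then show "(g has_field_derivative c) (at v)"
          by (rule has_field_derivative_transform_within_open[OF _ J(1) that])
            (use sum[OF \<open>u0 \<in> I\<close>] in \<open>smt (verit)\<close>)
      qed
      ultimately show "?affine c \<and> ?riccati c" by blast
    next
      assume *: "?affine c \<and> ?riccati c"
      then obtain a b where f_eq: "\<And>u. u \<in> I \<Longrightarrow> ?C a u \<noteq> 0 \<and> f u = ?h a u + b"
        unfolding solution by blast
      have "((\<lambda>v. g v - c * v) has_field_derivative 0) (at v)" if "v \<in> J" for v
        using g[rule_format, OF that, folded DERIV_deriv_iff_real_differentiable] * that
        by (auto intro!: derivative_eq_intros)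
      then have "\<exists>d. \<forall>v\<in>J. g v - c * v = d"
        by (rule constant_if_deriv_zero_on_interval[OF J(2,3)])
      then obtain d where d: "\<And>v. v \<in> J \<Longrightarrow> g v - c * v = d"
        by blast
      have "f u + g v = ?h a u + c * v + (b + d)" if "u \<in> I" "v \<in> J" for u v
        using f_eq[OF that(1)] d[OF that(2)] by linarith
      with f_eq
      show "\<exists>a b. ?form a b c"
        by blast
    qed
  qed
  then have "(\<exists>c a b. ?form a b c) \<longleftrightarrow> (\<exists>c. ?affine c \<and> ?riccati c)"
    by (simp only:)
  moreover have "(\<exists>a b c. Q a b c) \<longleftrightarrow> (\<exists>c a b. Q a b c)" for Q :: "real \<Rightarrow> real \<Rightarrow> real \<Rightarrow> bool"
    by blast
  ultimately show ?thesis
    by (rule trans[rotated])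
qed

text \<open>On an open interval a constant slope has derivative zero, so the equation in two variables
  collapses to the Riccati equation for the other slope.\<close>

lemma minimal_equation_iff_constant_slope:
  fixes f g :: "real \<Rightarrow> real"
  assumes I: "open I" "is_interval I" "I \<noteq> {}" and J: "open J" "is_interval J" "J \<noteq> {}"
    and f: "\<forall>u\<in>I. deriv f differentiable (at u)"
    and g: "\<forall>v\<in>J. deriv g differentiable (at v)"
  shows "(\<forall>u\<in>I. \<forall>v\<in>J.
      (1 + (deriv g v)\<^sup>2) * deriv (deriv f) u + (1 + (deriv f u)\<^sup>2) * deriv (deriv g) v =
        2 * (1 + (deriv f u)\<^sup>2 + (deriv g v)\<^sup>2)) \<longleftrightarrow>
    (\<exists>c. (\<forall>v\<in>J. deriv g v = c) \<and>
       (\<forall>u\<in>I. (1 + c\<^sup>2) * deriv (deriv f) u = 2 * (1 + c\<^sup>2 + (deriv f u)\<^sup>2))) \<or>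
    (\<exists>c. (\<forall>u\<in>I. deriv f u = c) \<and>
       (\<forall>v\<in>J. (1 + c\<^sup>2) * deriv (deriv g) v = 2 * (1 + c\<^sup>2 + (deriv g v)\<^sup>2)))"
    (is "?pde \<longleftrightarrow> (\<exists>c. ?g_affine c \<and> ?f_riccati c) \<or> (\<exists>c. ?f_affine c \<and> ?g_riccati c)")
proof -
  have g_affine: "?pde \<longleftrightarrow> ?f_riccati c" if "?g_affine c" for c
    using J(3) that deriv_zero_if_constant_on_open[OF J(1) _ that]
    by (auto simp: add_ac)
  have f_affine: "?pde \<longleftrightarrow> ?g_riccati c" if "?f_affine c" for c
    using I(3) that deriv_zero_if_constant_on_open[OF I(1) _ that]
    by (auto simp: add_ac)
  show ?thesis
  proof
    assume pde: ?pde
    have "(\<exists>c. ?f_affine c) \<or> (\<exists>c. ?g_affine c)"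
      by (rule minimal_equation_imp_constant_slope[OF I J]) (use f g pde in auto)
    then show "(\<exists>c. ?g_affine c \<and> ?f_riccati c) \<or> (\<exists>c. ?f_affine c \<and> ?g_riccati c)"
    proof (elim disjE exE)
      fix c assume c: "?f_affine c"
      with iffD1[OF f_affine[OF c] pde] show ?thesis by (intro disjI2 exI[of _ c] conjI)
    next
      fix c assume c: "?g_affine c"
      with iffD1[OF g_affine[OF c] pde] show ?thesis by (intro disjI1 exI[of _ c] conjI)
    qed
  next
    assume "(\<exists>c. ?g_affine c \<and> ?f_riccati c) \<or> (\<exists>c. ?f_affine c \<and> ?g_riccati c)"
    then show ?pde
    proof (elim disjE exE conjE)
      fix c assume c: "?g_affine c" and "?f_riccati c"
      then show ?pde by (intro iffD2[OF g_affine[OF c]])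
    next
      fix c assume c: "?f_affine c" and "?g_riccati c"
      then show ?pde by (intro iffD2[OF f_affine[OF c]])
    qed
  qed
qed

theorem theorem2p2:
  fixes I J :: "real set" and f g :: "real \<Rightarrow> real"
    and N :: "real \<times> real \<Rightarrow> real ^ 3"
  assumes "open I" and "is_interval I" and "I \<noteq> {}"
    and "open J" and "is_interval J" and "J \<noteq> {}"
    and "smooth_on I f" and "smooth_on J g"
    and "unit_normal_field (translation_surface f g) (I \<times> J) N"
  shows "minimal_surface (translation_surface f g) (I \<times> J) N \<longleftrightarrow>
    (\<exists>a b c :: real.
        (\<forall>u\<in>I. cos (2 / sqrt (c\<^sup>2 + 1) * u - a) \<noteq> 0) \<and>
        (\<forall>u\<in>I. \<forall>v\<in>J. translation_surface f g (u, v) =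
           vector [u, v, - ((c\<^sup>2 + 1) / 2) * ln \<bar>cos (2 / sqrt (c\<^sup>2 + 1) * u - a)\<bar> + c * v + b])) \<or>
    (\<exists>a b c :: real.
        (\<forall>v\<in>J. cos (2 / sqrt (c\<^sup>2 + 1) * v - a) \<noteq> 0) \<and>
        (\<forall>u\<in>I. \<forall>v\<in>J. translation_surface f g (u, v) =
           vector [u, v, - ((c\<^sup>2 + 1) / 2) * ln \<bar>cos (2 / sqrt (c\<^sup>2 + 1) * v - a)\<bar> + c * u + b]))"
proof -
  note I = assms(1-3) and J = assms(4-6)
  have diff: "\<forall>x\<in>S. h differentiable (at x)" "\<forall>x\<in>S. deriv h differentiable (at x)"
    if "smooth_on S h" for S h
    using that[unfolded smooth_on_def, THEN spec[where x = 0]]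
      that[unfolded smooth_on_def, THEN spec[where x = 1]] by simp_all
  note f = diff[OF assms(7)] and g = diff[OF assms(8)]
  have surface_eq: "translation_surface f g (u, v) = vector [u, v, z] \<longleftrightarrow> f u + g v = z" for u v z
    by (simp add: translation_surface_def vec_eq_iff forall_3)
  have swap: "(\<forall>v\<in>J. \<forall>u\<in>I. g v + f u = z u v) \<longleftrightarrow> (\<forall>u\<in>I. \<forall>v\<in>J. f u + g v = z u v)"
    for z
    by (auto simp: add.commute)
  have "minimal_surface (translation_surface f g) (I \<times> J) N \<longleftrightarrow> (\<forall>u\<in>I. \<forall>v\<in>J.
      (1 + (deriv g v)\<^sup>2) * deriv (deriv f) u + (1 + (deriv f u)\<^sup>2) * deriv (deriv g) v =
        2 * (1 + (deriv f u)\<^sup>2 + (deriv g v)\<^sup>2))"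
    using mean_curvature_translation_surface_eq_0_iff[OF I(1) J(1) _ _ _ _ _ _ assms(9)] f g
    by (auto simp: minimal_surface_def)
  also note minimal_equation_iff_constant_slope[OF I J f(2) g(2)]
  also note explicit_form_iff[OF I J f g(1), symmetric]
  also note explicit_form_iff[OF J I g f(1), symmetric]
  finally show ?thesis
    by (simp only: surface_eq swap)
qed

end
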